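(* Let $f$ and $g$ be as defined in the context, and assume that (i) $f(n,a)=f(n+1,a)$ for all $a,n\in\mathbb{N}^+$ with $n\ge\lceil\log_2 a\rceil+1$, and (ii) $g(n,m)=g(n+1,m)$ for all $m,n\in\mathbb{N}^+$ with $m\ge 2$ and $n\ge\lceil\log_2 m\rceil$. Then every union-closed family $\mathcal{F}$ with $m$ sets contains an element lying in at least $\frac{6}{13}m$ sets of the family, i.e. $a(\mathcal{F})\ge\frac{6}{13}m(\mathcal{F})$.
   Context: A family $\mathcal{F}$ on ground set $[n]=\{1,\dots,n\}$ is a collection $\mathcal{S}(\mathcal{F})$ of distinct subsets of $[n]$ (elements of $[n]$ may lie in no set); $m(\mathcal{F})=|\mathcal{S}(\mathcal{F})|$. It is union-closed if $S\cup T\in\mathcal{S}(\mathcal{F})$ whenever $S,T\in\mathcal{S}(\mathcal{F})$. For $e\in[n]$, $m_e(\mathcal{F})$ is the number of sets of $\mathcal{F}$ containing $e$, and $a(\mathcal{F})=\max_{e\in[n]}m_e(\mathcal{F})$. For $n,a\in\mathbb{N}^+$, $f(n,a)$ is the maximum of $m(\mathcal{F})$ over all union-closed families $\mathcal{F}$ on ground set $[n]$ with $\mathcal{S}(\mathcal{F})\neq\emptyset$ and $a(\mathcal{F})\le a$. For $n,m\in\mathbb{N}^+$ with $m\ge2$ and $m\le 2^n$, $g(n,m)$ is the minimum of $a(\mathcal{F})$ over all union-closed families $\mathcal{F}$ on ground set $[n]$ with $m(\mathcal{F})=m$.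
   Formalization: The family consisting only of the empty set is excluded: it is union-closed with m = 1 and a = 0, so the claimed bound a ≥ (6/13)m fails for it. *)

theory Defs
  imports Complex_Main
begin

text \<open>
  The ground set is \<open>[n] = {1..n}\<close>.  A family is a set of subsets of \<open>[n]\<close>; it need not cover \<open>[n]\<close>,
  so \<open>n\<close> is an explicit parameter and not recoverable from the family.
\<close>

definition family_on :: "nat \<Rightarrow> nat set set \<Rightarrow> bool" where
  "family_on n F \<longleftrightarrow> F \<subseteq> Pow {1..n}"

definition union_closed :: "nat set set \<Rightarrow> bool" where
  "union_closed F \<longleftrightarrow> (\<forall>S\<in>F. \<forall>T\<in>F. S \<union> T \<in> F)"

definition elem_freq :: "nat set set \<Rightarrow> nat \<Rightarrow> nat" where
  "elem_freq F e = card {S \<in> F. e \<in> S}"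

text \<open>Meaningful only for \<open>n \<ge> 1\<close>, since otherwise the maximum ranges over the empty set.\<close>

definition max_freq :: "nat \<Rightarrow> nat set set \<Rightarrow> nat" where
  "max_freq n F = Max (elem_freq F ` {1..n})"

text \<open>
  The next two are extrema over finite sets.  The set is nonempty for \<open>n, a \<ge> 1\<close> in the definition
  of \<open>f\<close> and for \<open>n \<ge> 1\<close>, \<open>2 \<le> m \<le> 2 ^ n\<close> in that of \<open>g\<close>; other arguments carry no meaning.
\<close>

definition f :: "nat \<Rightarrow> nat \<Rightarrow> nat" where
  "f n a = Max {card F | F. family_on n F \<and> union_closed F \<and> F \<noteq> {} \<and> max_freq n F \<le> a}"

definition g :: "nat \<Rightarrow> nat \<Rightarrow> nat" where
  "g n m = Min {max_freq n F | F. family_on n F \<and> union_closed F \<and> card F = m}"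

end

theory Submission
  imports Defs
begin

text \<open>
  Stability of \<open>g\<close> reduces the claim to a union-closed family of \<open>m\<close> sets on \<open>k = \<lceil>log\<^sub>2 m\<rceil>\<close> points,
  which is denser than \<open>1/2\<close> in the cube.  For such families Karpas's argument yields even the
  constant \<open>1/2\<close>.  A set outside a union-closed family has at most one lower neighbour in the
  family, so the edges of the cube leaving the family upwards are at most as many as the sets outside
  it.  If every element had frequency below one half, this would bound the total influence of the
  indicator of the family from above, against the spectral inequality
  \<open>influence + (level-1 weight) \<ge> 2 \<cdot> variance\<close>.
\<close>

section \<open>Influence and variance on the cube\<close>

definition cube_mean :: "'a set \<Rightarrow> ('a set \<Rightarrow> real) \<Rightarrow> real" where
  "cube_mean A h = (\<Sum>S\<in>Pow A. h S) / 2 ^ card A"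

text \<open>In Fourier terms this is the sum of |S| times the squared coefficient at S. For an
  indicator, each direction contributes a quarter of the proportion of its edges that change the
  value.\<close>

definition influence :: "'a set \<Rightarrow> ('a set \<Rightarrow> real) \<Rightarrow> real" where
  "influence A h = (\<Sum>i\<in>A. cube_mean (A - {i}) (\<lambda>S. ((h (insert i S) - h S) / 2)\<^sup>2))"

text \<open>Up to sign, the Fourier coefficient of \<open>h\<close> at the singleton \<open>{i}\<close>.\<close>

definition level1_coeff :: "'a set \<Rightarrow> ('a set \<Rightarrow> real) \<Rightarrow> 'a \<Rightarrow> real" where
  "level1_coeff A h i = cube_mean (A - {i}) (\<lambda>S. (h (insert i S) - h S) / 2)"

definition cube_var :: "'a set \<Rightarrow> ('a set \<Rightarrow> real) \<Rightarrow> real" where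
  "cube_var A h = cube_mean A (\<lambda>S. (h S)\<^sup>2) - (cube_mean A h)\<^sup>2"

section \<open>Means over the cube, split along one coordinate\<close>

lemma sum_Pow_insert:
  fixes h :: "'a set \<Rightarrow> 'b::comm_monoid_add"
  assumes "finite A" "a \<notin> A"
  shows "(\<Sum>S\<in>Pow (insert a A). h S) = (\<Sum>S\<in>Pow A. h S) + (\<Sum>S\<in>Pow A. h (insert a S))"
proof -
  have "inj_on (insert a) (Pow A)"
    using assms by (intro inj_onI) (metis Diff_insert_absorb PowD insert_absorb subset_iff)
  moreover have "Pow A \<inter> insert a ` Pow A = {}" using assms by auto
  ultimately show ?thesis
    using assms by (simp add: Pow_insert sum.union_disjoint sum.reindex)
qed

lemma cube_mean_empty [simp]: "cube_mean {} h = h {}"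
  by (simp add: cube_mean_def)

lemma cube_mean_insert:
  assumes "finite A" "a \<notin> A"
  shows "cube_mean (insert a A) h = cube_mean A (\<lambda>S. (h S + h (insert a S)) / 2)"
  using assms
  by (simp add: cube_mean_def sum_Pow_insert sum.distrib add_divide_distrib
      flip: sum_divide_distrib)

lemma cube_mean_add: "cube_mean A (\<lambda>S. h S + u S) = cube_mean A h + cube_mean A u"
  by (simp add: cube_mean_def sum.distrib add_divide_distrib)

lemma cube_mean_cong: "(\<And>S. S \<subseteq> A \<Longrightarrow> h S = u S) \<Longrightarrow> cube_mean A h = cube_mean A u"
  unfolding cube_mean_def by (intro arg_cong2[where f = "(/)"] sum.cong) auto

text \<open>\<open>u\<close> and \<open>v\<close> are the even and odd parts of \<open>h\<close> in
  direction \<open>a\<close>: \<open>h\<close> takes the value \<open>u + v\<close> off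
  \<open>a\<close> and \<open>u - v\<close> on \<open>a\<close>. All quantities on the larger cube
  reduce to these two functions on \<open>A\<close>.\<close>

context
  fixes A :: "'a set" and a :: 'a and h :: "'a set \<Rightarrow> real" and u v :: "'a set \<Rightarrow> real"
  defines "u \<equiv> \<lambda>S. (h S + h (insert a S)) / 2"
    and "v \<equiv> \<lambda>S. (h S - h (insert a S)) / 2"
  assumes fin: "finite A" and notin: "a \<notin> A"
begin

text \<open>In an old direction the parallelogram identity separates the squares of \<open>u\<close>
  and \<open>v\<close>; the new direction \<open>a\<close> contributes exactly the second moment of
  \<open>v\<close>.\<close>

lemma influence_insert:
  "influence (insert a A) h = influence A u + influence A v + cube_mean A (\<lambda>S. (v S)\<^sup>2)"
proof -
  have "cube_mean (insert a A - {i}) (\<lambda>S. ((h (insert i S) - h S) / 2)\<^sup>2)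
      = cube_mean (A - {i}) (\<lambda>S. ((u (insert i S) - u S) / 2)\<^sup>2)
      + cube_mean (A - {i}) (\<lambda>S. ((v (insert i S) - v S) / 2)\<^sup>2)" if "i \<in> A" for i
  proof -
    have eq: "insert a A - {i} = insert a (A - {i})" using that notin by auto
    show ?thesis
      unfolding eq using fin notin
      by (subst cube_mean_insert; simp)
        (auto simp: u_def v_def insert_commute power2_eq_square field_simps
          simp flip: cube_mean_add intro!: cube_mean_cong)
  qed
  moreover have "cube_mean (insert a A - {a}) (\<lambda>S. ((h (insert a S) - h S) / 2)\<^sup>2)
      = cube_mean A (\<lambda>S. (v S)\<^sup>2)"
    using notin by (simp add: v_def power2_commute power_divide)
  ultimately show ?thesis
    using fin notin by (simp add: influence_def sum.distrib)
qed

lemma level1_coeff_insert: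
  assumes "i \<in> A"
  shows "level1_coeff (insert a A) h i = level1_coeff A u i"
proof -
  have eq: "insert a A - {i} = insert a (A - {i})" using assms notin by auto
  show ?thesis
    unfolding level1_coeff_def eq using fin notin
    by (subst cube_mean_insert; simp)
      (auto simp: u_def insert_commute field_simps intro!: cube_mean_cong)
qed

lemma level1_coeff_insert_same: "(level1_coeff (insert a A) h a)\<^sup>2 = (cube_mean A v)\<^sup>2"
proof -
  have "level1_coeff (insert a A) h a = - cube_mean A v"
    using notin by (simp add: level1_coeff_def cube_mean_def v_def minus_divide_left flip: sum_negf)
  then show ?thesis by simp
qed

text \<open>The odd part has mean zero over the two halves, so it adds its full second
  moment.\<close>

lemma cube_var_insert: "cube_var (insert a A) h = cube_var A u + cube_mean A (\<lambda>S. (v S)\<^sup>2)"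
proof -
  have "cube_mean (insert a A) (\<lambda>S. (h S)\<^sup>2) = cube_mean A (\<lambda>S. (u S)\<^sup>2) + cube_mean A (\<lambda>S. (v S)\<^sup>2)"
    using fin notin
    by (subst cube_mean_insert)
      (auto simp: u_def v_def power2_eq_square field_simps
        simp flip: cube_mean_add intro!: cube_mean_cong)
  moreover have "cube_mean (insert a A) h = cube_mean A u"
    using fin notin by (simp add: cube_mean_insert u_def)
  ultimately show ?thesis by (simp add: cube_var_def)
qed

end

section \<open>Spectral inequalities by induction on the dimension\<close>

lemma influence_nonneg: "influence A h \<ge> 0"
  by (simp add: influence_def cube_mean_def sum_nonneg)

lemma poincare_cube:
  assumes "finite A"
  shows "cube_var A h \<le> influence A h"
  using assms
proof (induction A arbitrary: h)
  case empty
  then show ?case by (simp add: cube_var_def influence_def)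
next
  case (insert a A)
  show ?case
    using insert.hyps insert.IH[of "\<lambda>S. (h S + h (insert a S)) / 2"]
      influence_nonneg[of A "\<lambda>S. (h S - h (insert a S)) / 2"]
    by (simp add: influence_insert cube_var_insert)
qed

text \<open>In Fourier terms, |S| plus the indicator of |S| = 1 is at least 2 for every nonempty S.
  The induction avoids the expansion: the hypothesis handles \<open>u\<close>, and
  \<open>poincare_cube\<close> handles \<open>v\<close>.\<close>

lemma influence_level1_ge:
  assumes "finite A"
  shows "2 * cube_var A h \<le> influence A h + (\<Sum>i\<in>A. (level1_coeff A h i)\<^sup>2)"
  using assms
proof (induction A arbitrary: h)
  case empty
  then show ?case by (simp add: cube_var_def influence_def)
next
  case (insert a A)
  let ?u = "\<lambda>S. (h S + h (insert a S)) / 2" and ?v = "\<lambda>S. (h S - h (insert a S)) / 2"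
  have "(\<Sum>i\<in>insert a A. (level1_coeff (insert a A) h i)\<^sup>2)
      = (cube_mean A ?v)\<^sup>2 + (\<Sum>i\<in>A. (level1_coeff A ?u i)\<^sup>2)"
    using insert.hyps by (simp add: level1_coeff_insert level1_coeff_insert_same cong: sum.cong)
  moreover have "cube_mean A (\<lambda>S. (?v S)\<^sup>2) \<le> influence A ?v + (cube_mean A ?v)\<^sup>2"
    using poincare_cube[OF insert.hyps(1), of ?v] by (simp add: cube_var_def)
  ultimately show ?case
    using insert.hyps insert.IH[of ?u] by (simp add: influence_insert cube_var_insert)
qed

section \<open>Dense union-closed families\<close>

text \<open>Double counting of pairs (i, T) with T outside \<open>F\<close> and T - {i} in
  \<open>F\<close>: two distinct such lower neighbours would have union T, so each T occurs at most
  once.\<close>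

lemma card_upward_boundary_le:
  assumes fin: "finite A" and uc: "union_closed F"
  shows "(\<Sum>i\<in>A. card {S \<in> Pow (A - {i}). S \<in> F \<and> insert i S \<notin> F}) \<le> card (Pow A - F)"
proof -
  have one: "card {i \<in> A. i \<in> T \<and> T - {i} \<in> F} \<le> 1" if "T \<in> Pow A - F" for T
  proof -
    have "i = j" if "i \<in> T" "T - {i} \<in> F" "j \<in> T" "T - {j} \<in> F" for i j
    proof (rule ccontr)
      assume "i \<noteq> j"
      then have "(T - {i}) \<union> (T - {j}) = T" by auto
      then show False
        using uc that \<open>T \<in> Pow A - F\<close> unfolding union_closed_def by (metis DiffD2)
    qed
    then show ?thesis
      using fin by (auto simp: card_le_Suc0_iff_eq)
  qed
  \<comment> \<open>An edge leaving \<open>F\<close> upwards is recorded by its upper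
    endpoint.\<close>
  have "card {S \<in> Pow (A - {i}). S \<in> F \<and> insert i S \<notin> F}
      = card {T \<in> Pow A - F. i \<in> T \<and> T - {i} \<in> F}" if "i \<in> A" for i
    using that
    by (intro bij_betw_same_card[where f = "insert i"] bij_betw_byWitness[where f' = "\<lambda>T. T - {i}"])
      (auto simp: insert_absorb subset_Diff_insert)
  then have "(\<Sum>i\<in>A. card {S \<in> Pow (A - {i}). S \<in> F \<and> insert i S \<notin> F})
      = (\<Sum>i\<in>A. card {T \<in> Pow A - F. i \<in> T \<and> T - {i} \<in> F})"
    by simp
  also have "\<dots> = (\<Sum>i\<in>A. \<Sum>T\<in>Pow A - F. of_bool (i \<in> T \<and> T - {i} \<in> F))"
    using fin by (intro sum.cong refl) (simp add: of_bool_def sum.If_cases Int_def)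
  also have "\<dots> = (\<Sum>T\<in>Pow A - F. \<Sum>i\<in>A. of_bool (i \<in> T \<and> T - {i} \<in> F))"
    by (rule sum.swap)
  also have "\<dots> = (\<Sum>T\<in>Pow A - F. card {i \<in> A. i \<in> T \<and> T - {i} \<in> F})"
    using fin by (intro sum.cong refl) (simp add: of_bool_def sum.If_cases Int_def)
  also have "\<dots> \<le> (\<Sum>T\<in>Pow A - F. 1)"
    using one by (intro sum_mono)
  finally show ?thesis by simp
qed

text \<open>Translates frequency into Fourier language: the coefficient is negative exactly when
  \<open>i\<close> lies in fewer than half of the sets.\<close>

lemma level1_coeff_indicator:
  assumes fin: "finite A" and sub: "F \<subseteq> Pow A" and i: "i \<in> A"
  shows "2 ^ card A * level1_coeff A (\<lambda>S. of_bool (S \<in> F)) i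
    = 2 * real (card {S \<in> F. i \<in> S}) - real (card F)"
proof -
  let ?B = "Pow (A - {i})"
  have "finite F" using fin sub finite_subset by blast
  have pow: "(2::real) ^ card A = 2 * 2 ^ card (A - {i})"
    using fin i by (metis card_Suc_Diff1 power_Suc)
  have "card {S \<in> ?B. insert i S \<in> F} = card {S \<in> F. i \<in> S}"
    using sub i
    by (intro bij_betw_same_card[where f = "insert i"] bij_betw_byWitness[where f' = "\<lambda>T. T - {i}"])
      (auto simp: insert_absorb)
  then have up: "(\<Sum>S\<in>?B. of_bool (insert i S \<in> F)) = real (card {S \<in> F. i \<in> S})"
    using fin by (simp add: of_bool_def sum.If_cases Int_def)
  have "{S \<in> ?B. S \<in> F} = {S \<in> F. i \<notin> S}"
    using sub by auto
  then have low: "(\<Sum>S\<in>?B. of_bool (S \<in> F)) = real (card {S \<in> F. i \<notin> S})"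
    using fin by (simp add: of_bool_def sum.If_cases Int_def)
  have "card F = card ({S \<in> F. i \<in> S} \<union> {S \<in> F. i \<notin> S})"
    by (rule arg_cong[where f = card]) auto
  also have "\<dots> = card {S \<in> F. i \<in> S} + card {S \<in> F. i \<notin> S}"
    using \<open>finite F\<close> by (intro card_Un_disjoint) auto
  finally have "real (card F) = real (card {S \<in> F. i \<in> S}) + real (card {S \<in> F. i \<notin> S})"
    by simp
  then show ?thesis
    unfolding level1_coeff_def cube_mean_def pow
    by (simp add: up low sum_subtractf flip: sum_divide_distrib)
qed

lemma influence_indicator_le:
  assumes fin: "finite A" and sub: "F \<subseteq> Pow A" and uc: "union_closed F"
  defines "\<phi> \<equiv> \<lambda>S. of_bool (S \<in> F)"
  shows "influence A \<phi> \<le> real (card (Pow A - F)) / 2 ^ card A + (\<Sum>i\<in>A. level1_coeff A \<phi> i) / 2"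
proof -
  let ?U = "\<lambda>i. {S \<in> Pow (A - {i}). S \<in> F \<and> insert i S \<notin> F}"
  have "cube_mean (A - {i}) (\<lambda>S. ((\<phi> (insert i S) - \<phi> S) / 2)\<^sup>2)
      = real (card (?U i)) / 2 ^ card A + level1_coeff A \<phi> i / 2" if i: "i \<in> A" for i
  proof -
    have pow: "(2::real) ^ card A = 2 * 2 ^ card (A - {i})"
      using fin i by (metis card_Suc_Diff1 power_Suc)
    \<comment> \<open>For d in {-1, 0, 1}, (d/2)^2 equals d/4, plus 1/2 when d = -1. Only upward
      exits from \<open>F\<close> are thus counted; the rest is linear.\<close>
    have "cube_mean (A - {i}) (\<lambda>S. ((\<phi> (insert i S) - \<phi> S) / 2)\<^sup>2)
        = cube_mean (A - {i}) (\<lambda>S. of_bool (S \<in> F \<and> insert i S \<notin> F) / 2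
            + (\<phi> (insert i S) - \<phi> S) / 2 / 2)"
      by (intro cube_mean_cong) (auto simp: \<phi>_def of_bool_def power2_eq_square)
    also have "\<dots> = cube_mean (A - {i}) (\<lambda>S. of_bool (S \<in> F \<and> insert i S \<notin> F) / 2)
        + level1_coeff A \<phi> i / 2"
      unfolding cube_mean_add level1_coeff_def
      by (simp add: cube_mean_def flip: sum_divide_distrib)
    also have "cube_mean (A - {i}) (\<lambda>S. of_bool (S \<in> F \<and> insert i S \<notin> F) / 2)
        = real (card (?U i)) / 2 ^ card A"
      unfolding cube_mean_def pow using fin
      by (simp add: of_bool_def sum.If_cases Int_def flip: sum_divide_distrib)
    finally show ?thesis .
  qed
  then have "influence A \<phi> = real (\<Sum>i\<in>A. card (?U i)) / 2 ^ card A + (\<Sum>i\<in>A. level1_coeff A \<phi> i) / 2"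
    by (simp add: influence_def sum.distrib flip: sum_divide_distrib)
  also have "real (\<Sum>i\<in>A. card (?U i)) \<le> real (card (Pow A - F))"
    using card_upward_boundary_le[OF fin uc] by (rule of_nat_mono)
  finally show ?thesis by (simp add: divide_right_mono)
qed

text \<open>Let p < 1/2 be the density of the complement. If all elements were rare, the upper and
  lower bounds on the influence would give 2p(1 - p) \<le> p, which fails for 0 < p < 1/2.\<close>

theorem dense_union_closed_half_frequent:
  assumes fin: "finite A" and ne: "A \<noteq> {}" and sub: "F \<subseteq> Pow A" and uc: "union_closed F"
    and dense: "2 ^ card A < 2 * card F"
  shows "\<exists>i\<in>A. card F \<le> 2 * card {S \<in> F. i \<in> S}"
proof (rule ccontr)
  assume "\<not> ?thesis"
  then have rare: "2 * real (card {S \<in> F. i \<in> S}) < real (card F)" if "i \<in> A" for i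
    using that by force
  define \<phi> :: "nat set \<Rightarrow> real" where "\<phi> = (\<lambda>S. of_bool (S \<in> F))"
  define N :: real where "N = 2 ^ card A"
  define p where "p = real (card (Pow A - F)) / N"
  have "N > 0" by (simp add: N_def)
  have "finite F" using fin sub finite_subset by blast
  have "card F \<le> 2 ^ card A"
    using fin sub by (metis card_Pow card_mono finite_Pow_iff)
  then have card_compl: "real (card (Pow A - F)) = N - real (card F)"
    using \<open>finite F\<close> sub fin by (simp add: N_def card_Diff_subset card_Pow of_nat_diff)
  then have card_F: "real (card F) = (1 - p) * N"
    using \<open>N > 0\<close> by (simp add: p_def diff_divide_distrib)
  have neg: "level1_coeff A \<phi> i < 0" if "i \<in> A" for i
  proof -
    have "N * level1_coeff A \<phi> i < 0"
      using level1_coeff_indicator[OF fin sub that] rare[OF that] by (simp add: \<phi>_def N_def)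
    then show ?thesis using \<open>N > 0\<close> by (simp add: mult_less_0_iff)
  qed
  \<comment> \<open>At p = 0 the final inequality would be no contradiction; but the full cube has
    vanishing level-1 coefficients.\<close>
  have "p > 0"
  proof -
    have "F \<noteq> Pow A"
    proof
      assume full: "F = Pow A"
      obtain i where "i \<in> A" using ne by auto
      then have "level1_coeff A \<phi> i = 0"
        unfolding level1_coeff_def cube_mean_def \<phi>_def full
        by (auto intro!: sum.neutral)
      then show False using neg[OF \<open>i \<in> A\<close>] by simp
    qed
    then have "Pow A - F \<noteq> {}" using sub by auto
    then have "card (Pow A - F) > 0" using fin by (simp add: card_gt_0_iff)
    then show ?thesis using \<open>N > 0\<close> by (simp add: p_def)
  qed
  have "N < 2 * real (card F)"
    using dense unfolding N_def by (metis of_nat_less_iff of_nat_mult of_nat_numeral of_nat_power)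
  then have "p < 1 / 2"
    using card_compl \<open>N > 0\<close> by (simp add: p_def field_simps)
  have lower: "0 \<le> 1 / 2 + level1_coeff A \<phi> i" if "i \<in> A" for i
  proof -
    have "(\<Sum>S\<in>Pow (A - {i}). - 1 / 2) \<le> (\<Sum>S\<in>Pow (A - {i}). (\<phi> (insert i S) - \<phi> S) / 2)"
      by (intro sum_mono) (auto simp: \<phi>_def)
    then show ?thesis
      using fin by (simp add: level1_coeff_def cube_mean_def card_Pow field_simps)
  qed
  have "cube_mean A \<phi> = 1 - p"
    using fin sub card_F \<open>N > 0\<close>
    by (simp add: cube_mean_def \<phi>_def of_bool_def sum.If_cases Int_absorb1 flip: N_def)
  moreover have "(\<lambda>S. (\<phi> S)\<^sup>2) = \<phi>"
    by (auto simp: \<phi>_def)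
  ultimately have "cube_var A \<phi> = (1 - p) - (1 - p)\<^sup>2"
    by (simp add: cube_var_def)
  then have "cube_var A \<phi> = p * (1 - p)"
    by (simp add: power2_eq_square algebra_simps)
  then have "2 * (p * (1 - p)) \<le> p + (\<Sum>i\<in>A. level1_coeff A \<phi> i) / 2 + (\<Sum>i\<in>A. (level1_coeff A \<phi> i)\<^sup>2)"
    using influence_level1_ge[OF fin, of \<phi>] influence_indicator_le[OF fin sub uc]
    unfolding \<phi>_def p_def N_def by linarith
  \<comment> \<open>Each coefficient c satisfies -1/2 \<le> c < 0, so c/2 + c^2 = c(1/2 + c) is
    nonpositive.\<close>
  also have "\<dots> = p + (\<Sum>i\<in>A. level1_coeff A \<phi> i * (1 / 2 + level1_coeff A \<phi> i))"
    by (simp add: sum.distrib sum_divide_distrib power2_eq_square algebra_simps)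
  also have "\<dots> \<le> p"
    using sum_nonpos[OF mult_nonpos_nonneg[OF less_imp_le[OF neg] lower]] by simp
  finally have "p * (1 - 2 * p) \<le> 0" by (simp add: algebra_simps)
  moreover have "p * (1 - 2 * p) > 0"
    using \<open>p > 0\<close> \<open>p < 1 / 2\<close> by simp
  ultimately show False by simp
qed

section \<open>Reduction to the dense case\<close>

text \<open>An inclusion-minimal member is a union of two members only if both equal it, so it can
  be removed; repeating this reaches any smaller size.\<close>

lemma union_closed_subfamily_exists:
  assumes "finite F" "union_closed F" "m \<le> card F"
  shows "\<exists>G\<subseteq>F. union_closed G \<and> card G = m"
  using assms
proof (induction "card F - m" arbitrary: F)
  case 0
  then show ?case by auto
next
  case (Suc d)
  then have "F \<noteq> {}" by auto
  with Suc.prems obtain S where S: "S \<in> F" "\<And>T. T \<in> F \<Longrightarrow> T \<subseteq> S \<Longrightarrow> T = S"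
    using finite_has_minimal[of F] by metis
  have "union_closed (F - {S})"
    using Suc.prems(2) S(2) unfolding union_closed_def
    by (metis Diff_iff Un_upper1 insertCI singletonD)
  moreover have "card (F - {S}) = card F - 1" using S(1) Suc.prems(1) by simp
  moreover have "d = card F - 1 - m" "m \<le> card F - 1" using Suc.hyps(2) by linarith+
  ultimately obtain G where "G \<subseteq> F - {S}" "union_closed G" "card G = m"
    using Suc.hyps(1)[of "F - {S}"] Suc.prems(1) by (metis finite_Diff)
  then show ?case by blast
qed

section \<open>Extremal families for \<open>g\<close>\<close>

lemma finite_max_freqs: "finite {max_freq n F | F. family_on n F \<and> P F}"
proof -
  have "{max_freq n F | F. family_on n F \<and> P F} \<subseteq> max_freq n ` Pow (Pow {1..n})"
    by (auto simp: family_on_def)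
  then show ?thesis by (rule finite_subset) simp
qed

lemma g_le_max_freq:
  assumes "family_on n F" "union_closed F"
  shows "g n (card F) \<le> max_freq n F"
  unfolding g_def using assms by (intro Min_le finite_max_freqs) auto

text \<open>The minimum ranges over a nonempty set because the full power set can be thinned to
  exactly \<open>m\<close> sets.\<close>

lemma g_attained:
  assumes "m \<le> 2 ^ k"
  obtains G where "family_on k G" "union_closed G" "card G = m" "max_freq k G = g k m"
proof -
  have "union_closed (Pow {1..k})" by (auto simp: union_closed_def)
  then obtain G where "G \<subseteq> Pow {1..k}" "union_closed G" "card G = m"
    using union_closed_subfamily_exists[of "Pow {1..k}" m] assms by (auto simp: card_Pow)
  then have "{max_freq k F | F. family_on k F \<and> union_closed F \<and> card F = m} \<noteq> {}"
    by (auto simp: family_on_def)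
  from Min_in[OF finite_max_freqs this] show thesis
    using that by (auto simp: g_def)
qed

theorem theorem2p6:
  fixes n :: nat and F :: "nat set set"
  assumes f_stable: "\<And>k a :: nat. k \<ge> 1 \<Longrightarrow> a \<ge> 1 \<Longrightarrow> int k \<ge> \<lceil>log 2 (real a)\<rceil> + 1
                       \<Longrightarrow> f k a = f (k + 1) a"
    and g_stable: "\<And>k m :: nat. k \<ge> 1 \<Longrightarrow> m \<ge> 2 \<Longrightarrow> int k \<ge> \<lceil>log 2 (real m)\<rceil>
                       \<Longrightarrow> g k m = g (k + 1) m"
    and "n \<ge> 1"
    and "family_on n F"
    and "union_closed F"
    and "F \<noteq> {{}}"
  shows "(\<exists>e\<in>{1..n}. real (elem_freq F e) \<ge> 6 / 13 * real (card F))
         \<and> real (max_freq n F) \<ge> 6 / 13 * real (card F)"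
proof -
  define m where "m = card F"
  have freq_le: "elem_freq G e \<le> max_freq k G" if "e \<in> {1..k}" for G e k
    using that by (simp add: max_freq_def)
  have "m \<le> 2 * max_freq n F"
  proof (cases "m \<ge> 2")
    case True
    \<comment> \<open>The smallest cube with room for \<open>m\<close> sets: \<open>2 ^ k\<close> is
      at least \<open>m\<close> but below \<open>2 * m\<close>, which is the density required. Since
      \<open>m\<close> is at least 2, \<open>k\<close> is positive.\<close>
    define k where "k = nat \<lceil>log 2 (real m)\<rceil>"
    have "log 2 (real m) > 0" using True by simp
    then have k: "int k = \<lceil>log 2 (real m)\<rceil>" "k \<ge> 1"
      by (simp_all add: k_def Suc_le_eq)
    then have "log 2 (real m) \<le> real k" "real k < log 2 (real m) + 1"
      by linarith+
    then have "real m \<le> 2 powr real k" "2 powr (real k - 1) < real m"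
      using True by (simp_all add: log_le_iff less_log_iff flip: less_diff_eq diff_less_eq)
    then have "real m \<le> 2 ^ k" "2 ^ k < 2 * real m"
      by (simp_all add: powr_realpow powr_diff)
    then have upper: "m \<le> 2 ^ k" and dense: "2 ^ k < 2 * m"
      by (simp_all flip: of_nat_le_iff of_nat_less_iff[where 'a = real])
    \<comment> \<open>The given family fits into \<open>n\<close> dimensions, so
      \<open>k \<le> n\<close> and stability can be iterated from \<open>k\<close> up to
      \<open>n\<close>.\<close>
    have "m \<le> 2 ^ n"
      using \<open>family_on n F\<close> card_mono[of "Pow {1..n}" F] by (simp add: family_on_def m_def card_Pow)
    then have "(2::nat) ^ k < 2 ^ Suc n" using dense by simp
    then have "k < Suc n" by (rule power_less_imp_less_exp[rotated]) simp
    then have "k \<le> n" by simp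
    then have "g n m = g k m"
    proof (induction n rule: dec_induct)
      case (step j)
      then show ?case using g_stable[of j m] True k by simp
    qed simp
    obtain G where G: "family_on k G" "union_closed G" "card G = m" "max_freq k G = g k m"
      using g_attained[OF upper] .
    have "{1..k} \<noteq> {}" using k by simp
    then obtain i where i: "i \<in> {1..k}" "m \<le> 2 * elem_freq G i"
      using dense_union_closed_half_frequent[of "{1..k}" G] G dense
      by (auto simp: family_on_def elem_freq_def)
    then have "m \<le> 2 * max_freq k G" using freq_le[of i k G] by linarith
    also have "\<dots> \<le> 2 * max_freq n F"
      using G \<open>g n m = g k m\<close> g_le_max_freq[of n F] assms(4,5) by (simp add: m_def)
    finally show ?thesis .
  next
    \<comment> \<open>Below two sets the bound is direct: the empty family is trivial, and a single
      set is nonempty by \<open>F \<noteq> {{}}\<close>, so its elements have full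
      frequency.\<close>
    case False
    show ?thesis
    proof (cases "m = 0")
      case False
      with \<open>\<not> m \<ge> 2\<close> have "card F = 1" by (simp add: m_def)
      then obtain S where S: "F = {S}" by (rule card_1_singletonE)
      with \<open>F \<noteq> {{}}\<close> obtain e where "e \<in> S" by blast
      with S \<open>family_on n F\<close> have e: "e \<in> S" "e \<in> {1..n}"
        unfolding family_on_def by blast+
      have "{T \<in> F. e \<in> T} = {S}" using S e by auto
      then show ?thesis
        using freq_le[OF e(2), of F] \<open>card F = 1\<close> by (simp add: elem_freq_def m_def)
    qed simp
  qed
  \<comment> \<open>The constant 6/13 is below the 1/2 just obtained.\<close>
  then have max: "real (max_freq n F) \<ge> 6 / 13 * real (card F)"
    by (simp add: m_def)
  have "max_freq n F \<in> elem_freq F ` {1..n}"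
    unfolding max_freq_def using \<open>n \<ge> 1\<close> by (intro Max_in) auto
  then show ?thesis using max by auto
qed

end
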